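(* Let $t$ and $n$ be integers with $t\geq 1$ and $n\geq 2t+4$. Then \[ AR(n, P_4\cup tP_2)=AR(n,(t+2)P_2). \]
   Context: For a positive integer $n$ and a graph $H$, the anti-Ramsey number $AR(n,H)$ is the maximum number of colors in an edge-coloring of the complete graph $K_n$ that contains no rainbow copy of $H$ (a subgraph is rainbow if all its edges receive distinct colors). $P_l$ denotes the path on $l$ vertices, $G\cup G'$ denotes the vertex-disjoint union of graphs, and $tG$ denotes the disjoint union of $t$ copies of $G$. *)

theory Defs
  imports "HOL-Library.Ramsey"
begin

type_synonym 'a graph = "'a set \<times> 'a set set"

abbreviation verts :: "'a graph \<Rightarrow> 'a set" where "verts \<equiv> fst"
abbreviation edges :: "'a graph \<Rightarrow> 'a set set" where "edges \<equiv> snd"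

definition is_graph :: "'a graph \<Rightarrow> bool" where
  "is_graph G \<longleftrightarrow> finite (verts G) \<and> edges G \<subseteq> nsets (verts G) 2"

definition subgraph :: "'a graph \<Rightarrow> 'a graph \<Rightarrow> bool" where
  "subgraph F G \<longleftrightarrow> is_graph F \<and> verts F \<subseteq> verts G \<and> edges F \<subseteq> edges G"

definition graph_iso :: "'a graph \<Rightarrow> 'b graph \<Rightarrow> bool" where
  "graph_iso G H \<longleftrightarrow>
     (\<exists>f. bij_betw f (verts G) (verts H) \<and> edges H = (\<lambda>e. f ` e) ` edges G)"

definition complete_graph :: "nat \<Rightarrow> nat graph" where
  "complete_graph n = ({..<n}, nsets {..<n} 2)"

(* The parameter counts vertices, not edges. *)
definition path_graph :: "nat \<Rightarrow> nat graph" where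
  "path_graph l = ({..<l}, {{i, Suc i} | i. Suc i < l})"

definition disjoint_union :: "'a graph \<Rightarrow> 'b graph \<Rightarrow> ('a + 'b) graph" where
  "disjoint_union G H =
     (verts G <+> verts H, (\<lambda>e. Inl ` e) ` edges G \<union> (\<lambda>e. Inr ` e) ` edges H)"

definition copies :: "nat \<Rightarrow> 'a graph \<Rightarrow> (nat \<times> 'a) graph" where
  "copies t G = ({..<t} \<times> verts G, \<Union>i<t. (\<lambda>e. Pair i ` e) ` edges G)"

definition rainbow :: "('a set \<Rightarrow> 'c) \<Rightarrow> 'a graph \<Rightarrow> bool" where
  "rainbow c F \<longleftrightarrow> inj_on c (edges F)"

definition has_rainbow_copy :: "('a set \<Rightarrow> 'c) \<Rightarrow> 'a graph \<Rightarrow> 'b graph \<Rightarrow> bool" where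
  "has_rainbow_copy c G H \<longleftrightarrow> (\<exists>F. subgraph F G \<and> graph_iso H F \<and> rainbow c F)"

(* Colours are natural numbers; only the values of c on edges of the complete graph matter.
   The colour counts below form a finite set, which is nonempty once H has at least
   two edges (monochromatic colouring); otherwise the maximum may be unspecified. *)
definition color_counts :: "nat \<Rightarrow> 'b graph \<Rightarrow> nat set" where
  "color_counts n H =
     {card (c ` edges (complete_graph n)) | c :: nat set \<Rightarrow> nat.
        \<not> has_rainbow_copy c (complete_graph n) H}"

definition anti_Ramsey :: "nat \<Rightarrow> 'b graph \<Rightarrow> nat" where
  "anti_Ramsey n H = Max (color_counts n H)"

lemma finite_color_counts: "finite (color_counts n H)"
proof (rule finite_subset)
  have fin: "finite (edges (complete_graph n))"
    by (simp add: complete_graph_def finite_imp_finite_nsets)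
  show "color_counts n H \<subseteq> {..card (edges (complete_graph n))}"
    by (auto simp: color_counts_def intro: card_image_le[OF fin])
qed simp

lemma color_counts_nonempty:
  assumes "is_graph H" "e \<in> edges H" "e' \<in> edges H" "e \<noteq> e'"
  shows "color_counts n H \<noteq> {}"
proof -
  have "\<not> has_rainbow_copy (\<lambda>_. 0 :: nat) (complete_graph n) H"
  proof
    assume "has_rainbow_copy (\<lambda>_. 0 :: nat) (complete_graph n) H"
    then obtain F :: "nat graph" and f where r: "rainbow (\<lambda>_. 0 :: nat) F"
      and f: "bij_betw f (verts H) (verts F)" "edges F = (\<lambda>e. f ` e) ` edges H"
      unfolding has_rainbow_copy_def graph_iso_def by blast
    have "f ` e = f ` e'"
    proof (rule inj_onD)
      show "inj_on (\<lambda>_. 0 :: nat) (edges F)" using r by (simp only: rainbow_def)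
      show "f ` e \<in> edges F" "f ` e' \<in> edges F"
        unfolding f(2) using assms(2,3) by simp_all
    qed (rule refl)
    moreover have "e \<subseteq> verts H" "e' \<subseteq> verts H"
      using assms(1-3) unfolding is_graph_def nsets_def by blast+
    ultimately have "e = e'"
      by (simp only: inj_on_image_eq_iff[OF bij_betw_imp_inj_on[OF f(1)]])
    with assms(4) show False ..
  qed
  then show ?thesis unfolding color_counts_def by blast
qed

lemma is_graph_path: "is_graph (path_graph l)"
proof -
  have "{i, Suc i} \<in> nsets {..<l} 2" if "Suc i < l" for i
    using that by (simp add: nsets_def)
  then show ?thesis
    by (auto simp: is_graph_def path_graph_def)
qed

lemma is_graph_disjoint_union:
  assumes "is_graph G" "is_graph H"
  shows "is_graph (disjoint_union G H)"
proof -
  have "Inl ` e \<in> nsets (verts G <+> verts H) 2" if "e \<in> edges G" for e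
  proof -
    have "e \<in> nsets (verts G) 2" using that assms(1) by (auto simp: is_graph_def)
    then have "e \<subseteq> verts G" "finite e" "card e = 2" by (simp_all add: nsets_def)
    then show ?thesis by (auto simp: nsets_def card_image)
  qed
  moreover have "Inr ` e \<in> nsets (verts G <+> verts H) 2" if "e \<in> edges H" for e
  proof -
    have "e \<in> nsets (verts H) 2" using that assms(2) by (auto simp: is_graph_def)
    then have "e \<subseteq> verts H" "finite e" "card e = 2" by (simp_all add: nsets_def)
    then show ?thesis by (auto simp: nsets_def card_image)
  qed
  ultimately have "edges (disjoint_union G H) \<subseteq> nsets (verts (disjoint_union G H)) 2"
    unfolding disjoint_union_def by auto
  with assms show ?thesis
    by (simp add: is_graph_def disjoint_union_def)
qed

lemma is_graph_copies:
  assumes "is_graph G"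
  shows "is_graph (copies t G)"
proof -
  have "Pair i ` e \<in> nsets ({..<t} \<times> verts G) 2" if "i < t" "e \<in> edges G" for i e
  proof -
    have "e \<subseteq> verts G" "finite e" "card e = 2"
      using assms that(2) by (auto simp: is_graph_def nsets_def)
    then have "card (Pair i ` e) = 2"
      by (simp add: card_image inj_on_def)
    with \<open>e \<subseteq> verts G\<close> \<open>finite e\<close> that(1) show ?thesis
      by (auto simp: nsets_def)
  qed
  then have "edges (copies t G) \<subseteq> nsets (verts (copies t G)) 2"
    unfolding copies_def by auto
  with assms show ?thesis
    by (simp add: is_graph_def copies_def)
qed

end

theory Submission
  imports Defs
begin

text \<open>A copy of P_4 together with t copies of P_2 contains a matching of size t + 2, which gives one
inequality. Conversely, suppose a colouring has a rainbow matching M of size t + 2, but no rainbow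
copy of P_4 with t copies of P_2. Joining two edges of M by a third one shows that all edges inside
the vertex set of M use colours of M. A rainbow matching of size t + 3 is impossible, so the edges
disjoint from M use colours of M as well. Each of the n - 2(t + 2) remaining vertices contributes one
new colour, up to at most one further new colour per edge of M, so there are at most n colours
altogether. On the other hand, colouring a spanning star injectively and everything else with one
further colour uses n colours and has no rainbow matching of size 3.\<close>

section \<open>Rainbow copies as injective vertex maps\<close>

text \<open>A copy is determined by its vertex map. Edges of \<open>H\<close> lie inside
  \<open>verts H\<close>, so an injective map keeps distinct edges distinct, and being rainbow can
  be stated on the edges of \<open>H\<close> itself.\<close>

lemma has_rainbow_copy_iff_embedding:
  fixes G :: "'a graph" and H :: "'b graph"
  assumes "is_graph H"
  shows "has_rainbow_copy c G H \<longleftrightarrow>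
    (\<exists>f. inj_on f (verts H) \<and> f ` verts H \<subseteq> verts G \<and> (\<lambda>e. f ` e) ` edges H \<subseteq> edges G \<and>
         inj_on (\<lambda>e. c (f ` e)) (edges H))"
    (is "?L \<longleftrightarrow> ?R")
proof
  have sub: "e \<subseteq> verts H" if "e \<in> edges H" for e
    using assms that by (auto simp: is_graph_def nsets_def)
  have inj_edges: "inj_on (\<lambda>e. f ` e) (edges H)" if "inj_on f (verts H)" for f :: "'b \<Rightarrow> 'a"
    using that sub by (meson inj_onI inj_on_image_eq_iff)
  {
    assume ?L
    then obtain F f where F: "subgraph F G" "rainbow c F" and f: "bij_betw f (verts H) (verts F)"
      "edges F = (\<lambda>e. f ` e) ` edges H"
      by (auto simp: has_rainbow_copy_def graph_iso_def)
    from f have inj: "inj_on f (verts H)" by (simp add: bij_betw_def)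
    have "inj_on (c \<circ> (\<lambda>e. f ` e)) (edges H)"
      using comp_inj_on[OF inj_edges[OF inj]] F(2) f(2) by (metis rainbow_def)
    with F f inj show ?R
      by (intro exI[of _ f]) (auto simp: subgraph_def bij_betw_def comp_def)
  next
    assume ?R
    then obtain f where f: "inj_on f (verts H)" "f ` verts H \<subseteq> verts G"
      "(\<lambda>e. f ` e) ` edges H \<subseteq> edges G" "inj_on (\<lambda>e. c (f ` e)) (edges H)" by blast
    define F where "F = (f ` verts H, (\<lambda>e. f ` e) ` edges H)"
    have "f ` e \<in> nsets (f ` verts H) 2" if e: "e \<in> edges H" for e
    proof -
      have "card (f ` e) = card e"
        using sub[OF e] f(1) by (meson card_image inj_on_subset)
      with e assms show ?thesis
        by (auto simp: is_graph_def nsets_def)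
    qed
    then have "is_graph F"
      using assms by (auto simp: is_graph_def F_def)
    then have "subgraph F G" using f by (auto simp: subgraph_def F_def)
    moreover have "graph_iso H F"
      using f by (auto simp: graph_iso_def F_def bij_betw_def)
    moreover have "rainbow c F"
      using f(4) by (auto simp: rainbow_def F_def inj_on_def)
    ultimately show ?L unfolding has_rainbow_copy_def by blast
  }
qed

text \<open>Embeddings compose, so \<open>g\<close> only has to embed \<open>H'\<close> into
  \<open>H\<close>.\<close>

lemma has_rainbow_copy_mono:
  assumes "has_rainbow_copy c G H" "is_graph H" "is_graph H'"
    and g: "inj_on g (verts H')" "g ` verts H' \<subseteq> verts H" "(\<lambda>e. g ` e) ` edges H' \<subseteq> edges H"
  shows "has_rainbow_copy c G H'"
proof -
  from assms obtain f where f: "inj_on f (verts H)" "f ` verts H \<subseteq> verts G"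
    "(\<lambda>e. f ` e) ` edges H \<subseteq> edges G" "inj_on (\<lambda>e. c (f ` e)) (edges H)"
    by (auto simp: has_rainbow_copy_iff_embedding)
  have sub: "e \<subseteq> verts H'" if "e \<in> edges H'" for e
    using assms that by (auto simp: is_graph_def nsets_def)
  have "inj_on (f \<circ> g) (verts H')"
    using f(1) g by (meson comp_inj_on inj_on_subset)
  moreover have "inj_on (\<lambda>e. c ((f \<circ> g) ` e)) (edges H')"
  proof (rule inj_onI)
    fix d e assume de: "d \<in> edges H'" "e \<in> edges H'" "c ((f \<circ> g) ` d) = c ((f \<circ> g) ` e)"
    then have "g ` d = g ` e"
      using inj_onD[OF f(4), of "g ` d" "g ` e"] g(3) by (auto simp: image_comp)
    then show "d = e" using sub de g(1) by (meson inj_on_image_eq_iff)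
  qed
  moreover have "(f \<circ> g) ` verts H' \<subseteq> verts G"
    using f(2) g(2) by fastforce
  moreover have "(\<lambda>e. (f \<circ> g) ` e) ` edges H' \<subseteq> edges G"
    unfolding image_comp[symmetric] using f(3) g(3) by blast
  ultimately show ?thesis
    using assms(3) by (auto simp: has_rainbow_copy_iff_embedding intro!: exI[of _ "f \<circ> g"])
qed

section \<open>Explicit vertices and edges of the two forbidden graphs\<close>

lemma verts_path_graph [simp]: "verts (path_graph l) = {..<l}"
  by (simp add: path_graph_def)

lemma edges_path_graph_2: "edges (path_graph 2) = {{0, 1}}"
  by (auto simp: path_graph_def less_2_cases_iff numeral_2_eq_2)

lemma edges_path_graph_4: "edges (path_graph 4) = {{0, 1}, {1, 2}, {2, 3}}"
proof -
  have "Suc i < 4 \<longleftrightarrow> i = 0 \<or> i = 1 \<or> i = 2" for i by auto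
  then show ?thesis
    by (auto simp: path_graph_def numeral_2_eq_2 numeral_3_eq_3)
qed

lemma verts_copies [simp]: "verts (copies t G) = {..<t} \<times> verts G"
  by (simp add: copies_def)

lemma edges_copies_path_graph_2:
  "edges (copies t (path_graph 2)) = (\<lambda>i. {(i, 0), (i, 1)}) ` {..<t}"
  by (auto simp: copies_def edges_path_graph_2)

lemma edges_disjoint_union:
  "edges (disjoint_union G H) = (\<lambda>e. Inl ` e) ` edges G \<union> (\<lambda>e. Inr ` e) ` edges H"
  by (simp add: disjoint_union_def)

lemma verts_disjoint_union [simp]: "verts (disjoint_union G H) = verts G <+> verts H"
  by (simp add: disjoint_union_def)

abbreviation path_matching :: "nat \<Rightarrow> (nat + nat \<times> nat) graph" where
  "path_matching t \<equiv> disjoint_union (path_graph 4) (copies t (path_graph 2))"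

lemma is_graph_path_matching: "is_graph (path_matching t)"
  by (simp add: is_graph_disjoint_union is_graph_path is_graph_copies)

text \<open>The two end edges of the path are disjoint and supply the two additional matching
  edges.\<close>

lemma rainbow_path_matching_imp_rainbow_matching:
  assumes "has_rainbow_copy c G (path_matching t)"
  shows "has_rainbow_copy c G (copies (t + 2) (path_graph 2))"
proof (rule has_rainbow_copy_mono[OF assms])
  \<comment> \<open>Copy \<open>t\<close> goes to the path edge {0, 1} and copy \<open>t + 1\<close>
    to {2, 3}; the middle edge {1, 2} is dropped.\<close>
  let ?g = "\<lambda>(i, x :: nat). if i < t then Inr (i, x) else Inl (2 * (i - t) + x)"
  show "inj_on ?g (verts (copies (t + 2) (path_graph 2)))"
    by (auto simp: inj_on_def split: if_splits) presburger+
  show "?g ` verts (copies (t + 2) (path_graph 2)) \<subseteq> verts (path_matching t)"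
    by auto
  have "?g ` {(i, 0), (i, 1)} \<in> edges (path_matching t)" if i: "i < t + 2" for i
  proof -
    consider "i < t" | "i = t" | "i = t + 1" using i by linarith
    then show ?thesis
    proof cases
      case 1
      then have "?g ` {(i, 0), (i, 1)} = Inr ` {(i, 0), (i, 1)}" by simp
      with 1 show ?thesis by (simp only: edges_disjoint_union edges_copies_path_graph_2) blast
    next
      case 2
      then have "?g ` {(i, 0), (i, 1)} = Inl ` {0, 1}" by simp
      then show ?thesis by (simp only: edges_disjoint_union edges_path_graph_4) blast
    next
      case 3
      then have "?g ` {(i, 0), (i, 1)} = Inl ` {2, 3}" by (simp add: numeral_eq_Suc)
      then show ?thesis by (simp only: edges_disjoint_union edges_path_graph_4) blast
    qed
  qed
  then show "(\<lambda>e. ?g ` e) ` edges (copies (t + 2) (path_graph 2)) \<subseteq> edges (path_matching t)"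
    unfolding edges_copies_path_graph_2 by blast
qed (simp_all add: is_graph_path_matching is_graph_copies is_graph_path)

section \<open>Rainbow matchings as edge sets, and their translation to and from copies\<close>

definition rainbow_matching :: "nat \<Rightarrow> (nat set \<Rightarrow> 'c) \<Rightarrow> nat set set \<Rightarrow> bool" where
  "rainbow_matching n c M \<longleftrightarrow> M \<subseteq> nsets {..<n} 2 \<and> pairwise disjnt M \<and> inj_on c M"

lemma rainbow_matching_subset: "rainbow_matching n c M \<Longrightarrow> N \<subseteq> M \<Longrightarrow> rainbow_matching n c N"
  by (auto simp: rainbow_matching_def intro: pairwise_subset inj_on_subset)

lemma rainbow_matching_finite: "rainbow_matching n c M \<Longrightarrow> finite M"
  by (meson finite_imp_finite_nsets finite_lessThan finite_subset rainbow_matching_def)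

lemma rainbow_matching_disjoint:
  "rainbow_matching n c M \<Longrightarrow> d \<in> M \<Longrightarrow> e \<in> M \<Longrightarrow> d \<noteq> e \<Longrightarrow> d \<inter> e = {}"
  by (auto simp: rainbow_matching_def pairwise_def disjnt_def)

lemma rainbow_matching_colour_eq_iff:
  "rainbow_matching n c M \<Longrightarrow> d \<in> M \<Longrightarrow> e \<in> M \<Longrightarrow> c d = c e \<longleftrightarrow> d = e"
  by (auto simp: rainbow_matching_def inj_on_def)

lemma rainbow_matching_edge:
  "rainbow_matching n c M \<Longrightarrow> {a, b} \<in> M \<Longrightarrow> a \<noteq> b \<and> a < n \<and> b < n"
  by (auto simp: rainbow_matching_def nsets_def)

lemma rainbow_matching_edgeE:
  assumes "rainbow_matching n c M" "e \<in> M"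
  obtains a b where "e = {a, b}"
  using assms by (force simp: rainbow_matching_def nsets_def card_2_iff)

text \<open>Enumerate the edges of \<open>M\<close> and order the ends of each edge. The resulting
  map serves both for copies of a matching and for the matching part of
  \<open>path_matching t\<close>.\<close>

lemma rainbow_matching_embedding:
  assumes M: "rainbow_matching n c M" and "card M = t"
  obtains f :: "nat \<times> nat \<Rightarrow> nat" where "inj_on f ({..<t} \<times> {..<2})"
    "f ` ({..<t} \<times> {..<2}) = \<Union>M" "bij_betw (\<lambda>i. f ` {(i, 0), (i, 1)}) {..<t} M"
proof -
  obtain h where h: "bij_betw h {..<t} M"
    using ex_bij_betw_nat_finite[OF rainbow_matching_finite[OF M]] assms(2)
    by (auto simp: lessThan_atLeast0)
  have "\<exists>p q. h i = {p, q} \<and> p \<noteq> q" if "i < t" for i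
  proof -
    have "h i \<in> M" using h that by (auto simp: bij_betw_def)
    then show ?thesis using M rainbow_matching_edge by (metis rainbow_matching_edgeE)
  qed
  then obtain p q where pq: "\<And>i. i < t \<Longrightarrow> h i = {p i, q i} \<and> p i \<noteq> q i" by metis
  define f where "f = (\<lambda>(i, x). if x = (0 :: nat) then p i else q i)"
  have f: "f ` {(i, 0), (i, 1)} = h i" if "i < t" for i
    using pq[OF that] by (auto simp: f_def)
  have mem: "f (i, x) \<in> h i" if "i < t" "x < 2" for i x
    unfolding f[OF that(1), symmetric] using that(2) by (auto simp: less_2_cases_iff)
  have "i = j \<and> x = y" if *: "i < t" "j < t" "x < 2" "y < 2" "f (i, x) = f (j, y)" for i j x y
  proof -
    have "h i \<in> M" "h j \<in> M" using h * by (auto simp: bij_betw_def)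
    moreover have "f (i, x) \<in> h i" "f (i, x) \<in> h j"
      using mem[of i x] mem[of j y] * by simp_all
    ultimately have "h i = h j"
      using rainbow_matching_disjoint[OF M] by blast
    then have "i = j" using h * by (auto simp: bij_betw_def inj_on_def)
    then show ?thesis using * pq[of i] by (auto simp: f_def less_2_cases_iff split: if_splits)
  qed
  then have inj: "inj_on f ({..<t} \<times> {..<2})"
    by (auto simp: inj_on_def)
  have "f ` ({..<t} \<times> {..<2}) = (\<Union>i<t. f ` {(i, 0), (i, 1)})"
    by (auto simp: less_2_cases_iff)
  also have "\<dots> = (\<Union>i<t. h i)" using f by simp
  also have "\<dots> = \<Union>M" using h by (auto simp: bij_betw_def)
  finally have "f ` ({..<t} \<times> {..<2}) = \<Union>M" .
  moreover have "bij_betw (\<lambda>i. f ` {(i, 0), (i, 1)}) {..<t} M"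
    using h f by (subst bij_betw_cong[of _ _ h]) auto
  ultimately show ?thesis using that inj by blast
qed

lemma rainbow_matching_of_copy:
  assumes "has_rainbow_copy c (complete_graph n) (copies k (path_graph 2))"
  obtains M where "rainbow_matching n c M" "card M = k"
proof -
  obtain f :: "nat \<times> nat \<Rightarrow> nat" where f: "inj_on f ({..<k} \<times> {..<2})"
    "(\<lambda>i. f ` {(i, 0), (i, 1)}) ` {..<k} \<subseteq> nsets {..<n} 2"
    "inj_on (\<lambda>e. c (f ` e)) ((\<lambda>i. {(i, 0), (i, 1)}) ` {..<k})"
    using assms
    by (auto simp: has_rainbow_copy_iff_embedding is_graph_copies is_graph_path
        edges_copies_path_graph_2 complete_graph_def image_image)
  define h where "h i = f ` {(i, 0), (i, 1)}" for i
  have "inj_on (\<lambda>i. {(i, 0 :: nat), (i, 1)}) {..<k}"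
    by (auto simp: inj_on_def doubleton_eq_iff)
  from comp_inj_on[OF this f(3)] have ch: "inj_on (\<lambda>i. c (h i)) {..<k}"
    by (simp add: comp_def h_def)
  then have "inj_on h {..<k}" by (auto simp: inj_on_def)
  moreover have "pairwise disjnt (h ` {..<k})"
  proof (clarsimp simp: pairwise_def disjnt_def)
    fix i j assume *: "i < k" "j < k" "h i \<noteq> h j"
    then have "{(i, 0), (i, 1)} \<inter> {(j, 0), (j, 1 :: nat)} = {}" by auto
    then show "h i \<inter> h j = {}"
      unfolding h_def using inj_on_image_Int[OF f(1), of "{(i, 0), (i, 1)}" "{(j, 0), (j, 1)}"] *
      by auto
  qed
  moreover have "inj_on c (h ` {..<k})" using ch by (auto simp: inj_on_def)
  moreover have "h ` {..<k} \<subseteq> nsets {..<n} 2" using f(2) unfolding h_def .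
  ultimately show ?thesis using that[of "h ` {..<k}"]
    by (simp add: rainbow_matching_def card_image)
qed

lemma copy_of_rainbow_matching:
  assumes "rainbow_matching n c M" "card M = k"
  shows "has_rainbow_copy c (complete_graph n) (copies k (path_graph 2))"
proof -
  obtain f :: "nat \<times> nat \<Rightarrow> nat" where f: "inj_on f ({..<k} \<times> {..<2})"
    "f ` ({..<k} \<times> {..<2}) = \<Union>M" "bij_betw (\<lambda>i. f ` {(i, 0), (i, 1)}) {..<k} M"
    using rainbow_matching_embedding[OF assms] .
  have M: "M \<subseteq> nsets {..<n} 2" "inj_on c M" using assms by (auto simp: rainbow_matching_def)
  have "inj_on (\<lambda>i. c (f ` {(i, 0), (i, 1)})) {..<k}"
    using comp_inj_on[of "\<lambda>i. f ` {(i, 0), (i, 1)}" "{..<k}" c] f(3) M(2)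
    by (simp add: bij_betw_def comp_def)
  then have "inj_on (\<lambda>e. c (f ` e)) ((\<lambda>i. {(i, 0), (i, 1)}) ` {..<k})"
    by (auto simp: inj_on_def)
  moreover have "(\<lambda>i. f ` {(i, 0), (i, 1)}) ` {..<k} = M"
    using f(3) by (simp add: bij_betw_def)
  moreover have "f ` ({..<k} \<times> {..<2}) \<subseteq> {..<n}" unfolding f(2) using M(1) by (auto simp: nsets_def)
  ultimately show ?thesis
    using f(1) M(1)
    by (auto simp: has_rainbow_copy_iff_embedding is_graph_copies is_graph_path
        edges_copies_path_graph_2 complete_graph_def image_image intro!: exI[of _ f])
qed

text \<open>Path and matching are embedded separately. Injectivity on vertices and on colours is
  checked on each part; \<open>disj\<close> and the second part of \<open>col\<close> keep the two
  images apart.\<close>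

lemma copy_of_rainbow_path_matching:
  assumes N: "rainbow_matching n c N" "card N = t"
    and dist: "distinct [v0, v1, v2, v3]" and sub: "{v0, v1, v2, v3} \<subseteq> {..<n}"
    and disj: "{v0, v1, v2, v3} \<inter> \<Union>N = {}"
    and col: "distinct [c {v0, v1}, c {v1, v2}, c {v2, v3}]"
      "{c {v0, v1}, c {v1, v2}, c {v2, v3}} \<inter> c ` N = {}"
  shows "has_rainbow_copy c (complete_graph n) (path_matching t)"
proof -
  obtain f :: "nat \<times> nat \<Rightarrow> nat" where f: "inj_on f ({..<t} \<times> {..<2})"
    "f ` ({..<t} \<times> {..<2}) = \<Union>N" "bij_betw (\<lambda>i. f ` {(i, 0), (i, 1)}) {..<t} N"
    using rainbow_matching_embedding[OF N] .
  define g where "g = case_sum (\<lambda>i. [v0, v1, v2, v3] ! i) f"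
  let ?H = "path_matching t"
  have gr: "g (Inr x) = f x" for x by (simp add: g_def)
  have gl: "g (Inl 0) = v0" "g (Inl (Suc 0)) = v1" "g (Inl 2) = v2" "g (Inl 3) = v3"
    by (simp_all add: g_def)
  have four: "{..<4} = {0, Suc 0, 2, 3 :: nat}" by auto
  have V: "verts ?H = {Inl 0, Inl (Suc 0), Inl 2, Inl 3} \<union> Inr ` ({..<t} \<times> {..<2})"
    by (auto simp: four)
  define PE :: "(nat + nat \<times> nat) set set"
    where "PE = {{Inl 0, Inl (Suc 0)}, {Inl (Suc 0), Inl 2}, {Inl 2, Inl 3}}"
  define ME :: "(nat + nat \<times> nat) set set"
    where "ME = (\<lambda>i. {Inr (i, 0), Inr (i, 1)}) ` {..<t}"
  have E: "edges ?H = PE \<union> ME"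
    by (simp add: PE_def ME_def edges_disjoint_union edges_path_graph_4 edges_copies_path_graph_2
        image_image)
  have ME: "(\<lambda>e. g ` e) ` ME = N"
    using f(3) by (auto simp: ME_def image_image gr bij_betw_def)
  have Nn: "N \<subseteq> nsets {..<n} 2" "inj_on c N" using N by (auto simp: rainbow_matching_def)
  have "inj_on g (Inr ` ({..<t} \<times> {..<2}))"
    using f(1) by (auto simp: inj_on_def gr)
  moreover have "g ` {Inl 0, Inl (Suc 0), Inl 2, Inl 3} \<inter> g ` (Inr ` ({..<t} \<times> {..<2})) = {}"
    using disj by (simp only: image_image gr f(2) image_insert gl image_empty)
  moreover have "inj_on g {Inl 0, Inl (Suc 0), Inl 2, Inl 3}"
    using dist by (auto simp: inj_on_def gl)
  ultimately have "inj_on g (verts ?H)"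
    unfolding V by (subst inj_on_Un) blast
  moreover have "g ` verts ?H \<subseteq> {..<n}"
  proof -
    have "\<Union>N \<subseteq> {..<n}" using Nn by (auto simp: nsets_def)
    then show ?thesis unfolding V image_Un image_image gr f(2) using sub by (simp add: gl)
  qed
  moreover have "(\<lambda>e. g ` e) ` edges ?H \<subseteq> nsets {..<n} 2"
    using ME Nn sub dist by (auto simp: E image_Un PE_def gl nsets_def)
  moreover have "inj_on (\<lambda>e. c (g ` e)) (edges ?H)"
  proof -
    have "inj_on (\<lambda>e. c (g ` e)) PE"
      using col(1) by (auto simp: PE_def inj_on_def gl)
    moreover have "inj_on (\<lambda>e. c (g ` e)) ME"
    proof -
      have "inj_on (\<lambda>i. f ` {(i, 0), (i, 1)}) {..<t}" using f(3) by (simp add: bij_betw_def)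
      then have "inj_on (\<lambda>e. g ` e) ME"
        by (auto simp: ME_def inj_on_def gr)
      from comp_inj_on[OF this] ME Nn show ?thesis by (simp add: comp_def)
    qed
    moreover have "(\<lambda>e. c (g ` e)) ` PE \<inter> (\<lambda>e. c (g ` e)) ` ME = {}"
    proof -
      have "(\<lambda>e. c (g ` e)) ` ME = c ` N" using ME by (metis image_image)
      moreover have "(\<lambda>e. c (g ` e)) ` PE = {c {v0, v1}, c {v1, v2}, c {v2, v3}}"
        by (simp add: PE_def gl)
      ultimately show ?thesis using col(2) by simp
    qed
    ultimately show ?thesis unfolding E by (subst inj_on_Un) blast
  qed
  ultimately show ?thesis
    by (auto simp: has_rainbow_copy_iff_embedding is_graph_path_matching complete_graph_def
        intro!: exI[of _ g])
qed

section \<open>The lower bound: a colouring with \<open>n\<close> colours\<close>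

lemma order_in_color_counts_matching:
  assumes "k \<ge> 3" "n \<ge> 2 * k"
  shows "n \<in> color_counts n (copies k (path_graph 2))"
proof -
  \<comment> \<open>For i > 0 the star edge {0, i} has colour i, its maximum; colour 0 remains for
    all edges that avoid the centre 0.\<close>
  define c :: "nat set \<Rightarrow> nat" where "c e = (if 0 \<in> e then Max e else 0)" for e
  have "c ` nsets {..<n} 2 = {..<n}"
  proof
    have "Max e < n" if "e \<in> nsets {..<n} 2" for e
    proof -
      have "finite e" "e \<noteq> {}" "e \<subseteq> {..<n}" using that by (auto simp: nsets_def)
      then show ?thesis using Max_in by blast
    qed
    then show "c ` nsets {..<n} 2 \<subseteq> {..<n}" using assms by (auto simp: c_def)
    show "{..<n} \<subseteq> c ` nsets {..<n} 2"
    proof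
      fix i assume i: "i \<in> {..<n}"
      show "i \<in> c ` nsets {..<n} 2"
      proof (cases "i = 0")
        case True
        have "c {1, 2} = i" "{1, 2} \<in> nsets {..<n} 2"
          using True assms by (auto simp: c_def nsets_def)
        then show ?thesis by (metis imageI)
      next
        case False
        have "c {0, i} = i" "{0, i} \<in> nsets {..<n} 2"
          using False i by (auto simp: c_def nsets_def)
        then show ?thesis by (metis imageI)
      qed
    qed
  qed
  then have "card (c ` edges (complete_graph n)) = n"
    by (simp add: complete_graph_def)
  moreover have "\<not> has_rainbow_copy c (complete_graph n) (copies k (path_graph 2))"
  proof
    assume "has_rainbow_copy c (complete_graph n) (copies k (path_graph 2))"
    then obtain M where M: "rainbow_matching n c M" "card M = k"
      by (rule rainbow_matching_of_copy)
    \<comment> \<open>At most one matching edge passes through the centre, and at most one avoids it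
      because all those share a colour.\<close>
    have "card {e \<in> M. 0 \<in> e} \<le> Suc 0"
      using rainbow_matching_disjoint[OF M(1)] rainbow_matching_finite[OF M(1)]
      by (auto simp: card_le_Suc0_iff_eq)
    moreover have "d = e" if "d \<in> M" "e \<in> M" "0 \<notin> d" "0 \<notin> e" for d e
      using rainbow_matching_colour_eq_iff[OF M(1)] that by (metis c_def)
    then have "card {e \<in> M. 0 \<notin> e} \<le> Suc 0"
      using rainbow_matching_finite[OF M(1)] by (simp add: card_le_Suc0_iff_eq)
    moreover have "M = {e \<in> M. 0 \<in> e} \<union> {e \<in> M. 0 \<notin> e}" by blast
    ultimately have "card M \<le> 2"
      by (metis (no_types, lifting) add_mono card_Un_le le_trans one_add_one One_nat_def)
    with M assms show False by simp
  qed
  ultimately show ?thesis unfolding color_counts_def by (auto intro!: exI[of _ c])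
qed

section \<open>Constraints on colourings without a rainbow copy of
  \<open>path_matching t\<close>\<close>

locale no_rainbow_path_matching =
  fixes c :: "nat set \<Rightarrow> 'c" and n t :: nat
  assumes no_copy: "\<not> has_rainbow_copy c (complete_graph n) (path_matching t)"
begin

text \<open>\<open>S\<close> collects the matching edges sacrificed to the path: only their vertices
  and colours may be touched by it. At least \<open>t\<close> edges of \<open>M\<close> survive and
  complete the forbidden copy.\<close>

lemma no_rainbow_path:
  assumes M: "rainbow_matching n c M" and S: "S \<subseteq> M" "t + card S \<le> card M"
    and dist: "distinct [v0, v1, v2, v3]" and sub: "{v0, v1, v2, v3} \<subseteq> {..<n}"
    and meet: "{v0, v1, v2, v3} \<inter> \<Union>M \<subseteq> \<Union>S"
    and col: "distinct [c {v0, v1}, c {v1, v2}, c {v2, v3}]"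
      "{c {v0, v1}, c {v1, v2}, c {v2, v3}} \<inter> c ` M \<subseteq> c ` S"
  shows False
proof -
  have "card (M - S) \<ge> t"
    using S by (simp add: card_Diff_subset finite_subset[OF S(1) rainbow_matching_finite[OF M]])
  then obtain N where N: "N \<subseteq> M - S" "card N = t"
    by (meson obtain_subset_with_card_n)
  have NM: "rainbow_matching n c N"
    using N(1) by (intro rainbow_matching_subset[OF M]) blast
  have "v \<notin> \<Union>N" if "v \<in> {v0, v1, v2, v3}" for v
  proof
    assume "v \<in> \<Union>N"
    then obtain d where d: "d \<in> N" "v \<in> d" by blast
    with N that meet obtain e where "e \<in> S" "v \<in> e" by blast
    with d N S rainbow_matching_disjoint[OF M, of d e] show False by blast
  qed
  moreover have "q \<notin> c ` N" if "q \<in> {c {v0, v1}, c {v1, v2}, c {v2, v3}}" for q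
  proof
    assume "q \<in> c ` N"
    then obtain d where d: "d \<in> N" "q = c d" by blast
    with N that col(2) obtain e where "e \<in> S" "q = c e" by blast
    with d N S rainbow_matching_colour_eq_iff[OF M, of d e] show False by blast
  qed
  ultimately show False
    using copy_of_rainbow_path_matching[OF NM N(2) dist sub _ col(1)] no_copy by blast
qed

text \<open>With a new colour on the joining edge, the path a, b, p, q would be rainbow at the cost
  of only the two edges it contains.\<close>

lemma cross_colour_in:
  assumes M: "rainbow_matching n c M" "card M \<ge> t + 2"
    and e: "{a, b} \<in> M" "{p, q} \<in> M" "{a, b} \<noteq> {p, q}"
  shows "c {b, p} \<in> c ` M"
proof (rule ccontr)
  assume new: "c {b, p} \<notin> c ` M"
  have cols: "c {a, b} \<noteq> c {p, q}" "c {a, b} \<in> c ` M" "c {p, q} \<in> c ` M"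
    using rainbow_matching_colour_eq_iff[OF M(1)] e by simp_all
  have less: "a < n" "b < n" "p < n" "q < n" "a \<noteq> b" "p \<noteq> q"
    using e rainbow_matching_edge[OF M(1)] by blast+
  show False
  proof (rule no_rainbow_path[OF M(1), of "{{a, b}, {p, q}}" a b p q])
    show "distinct [a, b, p, q]"
      using rainbow_matching_disjoint[OF M(1) e] less by auto
    show "distinct [c {a, b}, c {b, p}, c {p, q}]"
      using new cols by auto
    show "{c {a, b}, c {b, p}, c {p, q}} \<inter> c ` M \<subseteq> c ` {{a, b}, {p, q}}"
      using new by blast
  qed (use e M(2) less in auto)
qed

text \<open>The larger matching allows a third sacrifice, so the joining edge cannot borrow the
  colour of another edge \<open>d\<close> either.\<close>

lemma cross_colour_ends:
  assumes M: "rainbow_matching n c M" "card M \<ge> t + 3"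
    and e: "{a, b} \<in> M" "{p, q} \<in> M" "{a, b} \<noteq> {p, q}"
  shows "c {b, p} = c {a, b} \<or> c {b, p} = c {p, q}"
proof (rule ccontr)
  assume other: "\<not> ?thesis"
  obtain d where d: "d \<in> M" "c {b, p} = c d"
    using cross_colour_in[OF M(1) _ e] M(2) by auto
  have cols: "c {a, b} \<noteq> c {p, q}"
    using rainbow_matching_colour_eq_iff[OF M(1)] e by simp
  have less: "a < n" "b < n" "p < n" "q < n" "a \<noteq> b" "p \<noteq> q"
    using e rainbow_matching_edge[OF M(1)] by blast+
  show False
  proof (rule no_rainbow_path[OF M(1), of "{{a, b}, {p, q}, d}" a b p q])
    have "card {{a, b}, {p, q}, d} \<le> 3" by (simp add: card_insert_if)
    then show "t + card {{a, b}, {p, q}, d} \<le> card M" using M(2) by linarith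
    show "distinct [a, b, p, q]"
      using rainbow_matching_disjoint[OF M(1) e] less by auto
    show "distinct [c {a, b}, c {b, p}, c {p, q}]"
      using other cols by auto
    show "{c {a, b}, c {b, p}, c {p, q}} \<inter> c ` M \<subseteq> c ` {{a, b}, {p, q}, d}"
      using d by blast
    show "{a, b, p, q} \<inter> \<Union>M \<subseteq> \<Union>{{a, b}, {p, q}, d}" by blast
  qed (use d e less in simp_all)
qed

text \<open>The path a, b, p, r would carry exactly the colours of the three matching edges it
  meets; sacrificing those three still leaves \<open>t\<close>.\<close>

lemma no_rainbow_directed_path:
  assumes M: "rainbow_matching n c M" "card M \<ge> t + 3"
    and e: "{a, b} \<in> M" "{p, q} \<in> M" "{r, s} \<in> M"
      "{a, b} \<noteq> {p, q}" "{a, b} \<noteq> {r, s}" "{p, q} \<noteq> {r, s}"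
  shows "\<not> (c {b, p} = c {p, q} \<and> c {p, r} = c {r, s})"
proof
  assume dir: "c {b, p} = c {p, q} \<and> c {p, r} = c {r, s}"
  have cols: "c {a, b} \<noteq> c {p, q}" "c {a, b} \<noteq> c {r, s}" "c {p, q} \<noteq> c {r, s}"
    using rainbow_matching_colour_eq_iff[OF M(1)] e by simp_all
  have less: "a < n" "b < n" "p < n" "r < n" "a \<noteq> b"
    using e rainbow_matching_edge[OF M(1)] by blast+
  have disj: "{a, b} \<inter> {p, q} = {}" "{a, b} \<inter> {r, s} = {}" "{p, q} \<inter> {r, s} = {}"
    using rainbow_matching_disjoint[OF M(1)] e by metis+
  show False
  proof (rule no_rainbow_path[OF M(1), of "{{a, b}, {p, q}, {r, s}}" a b p r])
    have "card {{a, b}, {p, q}, {r, s}} \<le> 3" by (simp add: card_insert_if)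
    then show "t + card {{a, b}, {p, q}, {r, s}} \<le> card M" using M(2) by linarith
    show "distinct [a, b, p, r]" using disj less by auto
    show "distinct [c {a, b}, c {b, p}, c {p, r}]" using dir cols by auto
    show "{c {a, b}, c {b, p}, c {p, r}} \<inter> c ` M \<subseteq> c ` {{a, b}, {p, q}, {r, s}}"
      using dir by auto
    show "{a, b, p, r} \<inter> \<Union>M \<subseteq> \<Union>{{a, b}, {p, q}, {r, s}}" by blast
  qed (use e less in simp_all)
qed

text \<open>Take one end of each of three matching edges. By \<open>cross_colour_ends\<close> the
  triangle on these ends becomes a tournament, and \<open>no_rainbow_directed_path\<close> rules out
  its directed paths.\<close>

lemma card_rainbow_matching_less:
  assumes M: "rainbow_matching n c M"
  shows "card M < t + 3"
proof (rule ccontr)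
  assume "\<not> ?thesis"
  then have card: "card M \<ge> t + 3" "card M \<ge> 3" by simp_all
  from card(2) obtain T where "T \<subseteq> M" "card T = 3"
    by (meson obtain_subset_with_card_n)
  then obtain d e f where def: "d \<in> M" "e \<in> M" "f \<in> M" "d \<noteq> e" "d \<noteq> f" "e \<noteq> f"
    by (auto simp: card_3_iff)
  obtain x x' y y' z z' where xyz: "d = {x, x'}" "e = {y, y'}" "f = {z, z'}"
    using def by (metis rainbow_matching_edgeE[OF M])
  have dir: "\<not> (c {b, p} = c {p, q} \<and> c {p, r} = c {r, s})"
    if "{a, b} \<in> M" "{p, q} \<in> M" "{r, s} \<in> M" "{a, b} \<noteq> {p, q}" "{a, b} \<noteq> {r, s}" "{p, q} \<noteq> {r, s}"
    for a b p q r s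
    using no_rainbow_directed_path[OF M card(1) that] .
  have comm: "{y, x} = {x, y}" "{z, x} = {x, z}" "{z, y} = {y, z}"
    "{x', x} = {x, x'}" "{y', y} = {y, y'}" "{z', z} = {z, z'}" by blast+
  have ends: "c {x, y} = c {x, x'} \<or> c {x, y} = c {y, y'}"
    "c {x, z} = c {x, x'} \<or> c {x, z} = c {z, z'}"
    "c {y, z} = c {y, y'} \<or> c {y, z} = c {z, z'}"
    using cross_colour_ends[OF M card(1), of x' x y y'] cross_colour_ends[OF M card(1), of x' x z z']
      cross_colour_ends[OF M card(1), of y' y z z'] def unfolding xyz comm
    by simp_all
  \<comment> \<open>Orient each of the three edges towards the matching edge whose colour it has: every tournament
    on three vertices has a directed path through all of them.\<close>
  show False
    using ends dir[of x' x y y' z z'] dir[of x' x z z' y y'] dir[of y' y x x' z z']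
      dir[of y' y z z' x x'] dir[of z' z x x' y y'] dir[of z' z y y' x x'] def
    unfolding xyz comm by metis
qed

section \<open>Counting colours around a rainbow matching of the largest possible size\<close>

context
  fixes M
  assumes M: "rainbow_matching n c M" and card_M: "card M = t + 2"
begin

lemma inside_colour:
  assumes "a \<in> \<Union>M" "p \<in> \<Union>M" "a \<noteq> p"
  shows "c {a, p} \<in> c ` M"
proof -
  obtain d e where de: "d \<in> M" "a \<in> d" "e \<in> M" "p \<in> e" using assms by blast
  obtain b where b: "d = {b, a}"
    using de rainbow_matching_edgeE[OF M de(1)] by (metis insertE insert_commute singletonD)
  obtain q where q: "e = {p, q}"
    using de rainbow_matching_edgeE[OF M de(3)] by (metis insertE insert_commute singletonD)
  show ?thesis
  proof (cases "d = e")
    case True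
    then have "{a, p} = d" using b q assms(3) by auto
    with de show ?thesis by simp
  next
    case False
    with cross_colour_in[OF M, of b a p q] de b q card_M show ?thesis by simp
  qed
qed

text \<open>A new colour would extend \<open>M\<close> to a rainbow matching of size t + 3.\<close>

lemma outside_colour:
  assumes "v \<notin> \<Union>M" "w \<notin> \<Union>M" "v \<noteq> w" "v < n" "w < n"
  shows "c {v, w} \<in> c ` M"
proof (rule ccontr)
  assume new: "c {v, w} \<notin> c ` M"
  have "rainbow_matching n c (insert {v, w} M)"
    using M assms new
    by (auto simp: rainbow_matching_def pairwise_insert disjnt_def nsets_def)
  moreover have "card (insert {v, w} M) = t + 3"
    using new card_M rainbow_matching_finite[OF M] by (subst card_insert_disjoint) auto
  ultimately show False using card_rainbow_matching_less by fastforce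
qed

text \<open>Otherwise u, v, w, x is a rainbow path that costs only {u, v} and the edge at
  \<open>x\<close>. Hence two different new colours at \<open>w\<close> come from the two ends of a
  single matching edge.\<close>

lemma new_colours_at_vertex:
  assumes w: "w \<notin> \<Union>M" "w < n" and e: "{u, v} \<in> M" and x: "x \<in> \<Union>M"
    and new: "c {w, v} \<notin> c ` M" "c {w, x} \<notin> c ` M" "c {w, v} \<noteq> c {w, x}"
  shows "x = u"
proof (rule ccontr)
  assume xu: "x \<noteq> u"
  from x obtain d where d: "d \<in> M" "x \<in> d" by blast
  have dist: "distinct [u, v, w, x]"
    using rainbow_matching_edge[OF M e] e w x new xu by auto
  have sub: "{u, v, w, x} \<subseteq> {..<n}"
    using rainbow_matching_edge[OF M e] M w d by (auto simp: rainbow_matching_def nsets_def)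
  show False
  proof (rule no_rainbow_path[OF M, of "{{u, v}, d}" u v w x])
    have "card {{u, v}, d} \<le> 2" by (simp add: card_insert_if)
    then show "t + card {{u, v}, d} \<le> card M" using card_M by linarith
    have "c {v, w} = c {w, v}" "c {u, v} \<noteq> c {w, v}" "c {u, v} \<noteq> c {w, x}"
      using new e by (auto simp: insert_commute) (metis imageI)+
    then show "distinct [c {u, v}, c {v, w}, c {w, x}]"
      and "{c {u, v}, c {v, w}, c {w, x}} \<inter> c ` M \<subseteq> c ` {{u, v}, d}"
      using new e by auto
    show "{u, v, w, x} \<inter> \<Union>M \<subseteq> \<Union>{{u, v}, d}" using w d by blast
  qed (use dist sub d e in simp_all)
qed

text \<open>Otherwise w, u, v, w' is a rainbow path that costs only the edge {u, v}.\<close>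

lemma new_colours_at_edge:
  assumes w: "w \<notin> \<Union>M" "w < n" "w' \<notin> \<Union>M" "w' < n" "w \<noteq> w'" and e: "{u, v} \<in> M"
    and new: "c {w, u} \<notin> c ` M" "c {w', v} \<notin> c ` M"
  shows "c {w, u} = c {w', v}"
proof (rule ccontr)
  assume neq: "\<not> ?thesis"
  have dist: "distinct [w, u, v, w']" "{w, u, v, w'} \<subseteq> {..<n}"
    using rainbow_matching_edge[OF M e] e w by auto
  show False
  proof (rule no_rainbow_path[OF M, of "{{u, v}}" w u v w'])
    have "c {v, w'} = c {w', v}" "c {u, v} \<noteq> c {w', v}" "c {u, v} \<noteq> c {w, u}"
      using new e by (auto simp: insert_commute) (metis imageI)+
    then show "distinct [c {w, u}, c {u, v}, c {v, w'}]"
      and "{c {w, u}, c {u, v}, c {v, w'}} \<inter> c ` M \<subseteq> c ` {{u, v}}"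
      using new neq e by auto
    show "{w, u, v, w'} \<inter> \<Union>M \<subseteq> \<Union>{{u, v}}" using w by blast
  qed (use dist e card_M in simp_all)
qed

lemma card_Union_M: "card (\<Union>M) = 2 * (t + 2)"
proof -
  have "card (\<Union>M) = sum card M"
    using M by (intro card_Union_disjoint) (auto simp: rainbow_matching_def nsets_def)
  also have "\<dots> = (\<Sum>e\<in>M. 2)"
    using M by (intro sum.cong) (auto simp: rainbow_matching_def nsets_def)
  finally show ?thesis by (simp add: card_M)
qed

text \<open>There are t + 2 colours on \<open>M\<close> and at most \<open>card W\<close> + (t + 2)
  new ones, and \<open>M\<close> covers 2(t + 2) vertices, so the sum is exactly
  \<open>n\<close>.\<close>

lemma card_colours_le: "card (c ` nsets {..<n} 2) \<le> n"
proof -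
  define W where "W = {..<n} - \<Union>M"
  define New where "New = c ` nsets {..<n} 2 - c ` M"
  have fin: "finite M" "finite W" "finite New"
    using rainbow_matching_finite[OF M] by (auto simp: W_def New_def finite_imp_finite_nsets)
  have UM: "\<Union>M \<subseteq> {..<n}" using M by (auto simp: rainbow_matching_def nsets_def)
  have W: "w \<notin> \<Union>M" "w < n" if "w \<in> W" for w using that by (auto simp: W_def)
  have New: "q \<notin> c ` M" if "q \<in> New" for q using that by (simp add: New_def)
  \<comment> \<open>Edges with both ends covered or both uncovered have colours of \<open>M\<close>,
    so every new colour sits on a crossing edge.\<close>
  have ex: "\<exists>w\<in>W. \<exists>e\<in>M. \<exists>v\<in>e. q = c {w, v}" if q: "q \<in> New" for q
  proof -
    obtain a b where ab: "q = c {a, b}" "a \<noteq> b" "a < n" "b < n"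
      using q by (auto simp: New_def nsets_def card_2_iff)
    have "a \<in> \<Union>M \<longleftrightarrow> b \<notin> \<Union>M"
      using inside_colour[of a b] outside_colour[of a b] New[OF q] ab by blast
    then consider "a \<in> \<Union>M" "b \<in> W" | "a \<in> W" "b \<in> \<Union>M"
      using ab by (auto simp: W_def)
    moreover have "q = c {b, a}" using ab by (simp add: insert_commute)
    ultimately show ?thesis using ab(1) by cases blast+
  qed
  \<comment> \<open>A vertex outside the matching sees at most two new colours; discount one of them, \<^term>\<open>g w\<close>.
    A remaining colour then comes from a triangle over a matching edge, and that edge determines it.\<close>
  define g where "g w = (SOME q. q \<in> New \<and> (\<exists>x\<in>\<Union>M. q = c {w, x}))" for w
  have g: "g w \<in> New \<and> (\<exists>x\<in>\<Union>M. g w = c {w, x})" if "c {w, v} \<in> New" "v \<in> \<Union>M" for w v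
    unfolding g_def using someI[of "\<lambda>q. q \<in> New \<and> (\<exists>x\<in>\<Union>M. q = c {w, x})" "c {w, v}"] that by blast
  have "\<forall>q\<in>New - g ` W. \<exists>e\<in>M. \<exists>w\<in>W. \<exists>v\<in>e. q = c {w, v}"
    using ex by blast
  then obtain h where h: "\<forall>q\<in>New - g ` W. h q \<in> M \<and> (\<exists>w\<in>W. \<exists>v\<in>h q. q = c {w, v})"
    by metis
  have "inj_on h (New - g ` W)"
  proof (rule inj_onI)
    fix q q' assume q: "q \<in> New - g ` W" and q': "q' \<in> New - g ` W" and eq: "h q = h q'"
    obtain w v where wv: "w \<in> W" "v \<in> h q" "q = c {w, v}" using h q by blast
    obtain w' v' where wv': "w' \<in> W" "v' \<in> h q" "q' = c {w', v'}" using h q' eq by metis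
    have hM: "h q \<in> M" using h q by blast
    obtain u where u: "h q = {u, v}"
      using wv(2) rainbow_matching_edgeE[OF M hM] by (metis insertE insert_commute singletonD)
    have "v \<in> \<Union>M" using hM wv by blast
    then obtain x where x: "g w \<in> New" "x \<in> \<Union>M" "g w = c {w, x}"
      using g[of w v] q wv by blast
    have "g w \<in> g ` W" using wv(1) by (rule imageI)
    then have gw: "g w \<noteq> q" "g w \<noteq> q'" using q q' by (metis DiffD2)+
    \<comment> \<open>\<open>w\<close> sees the two new colours \<open>q\<close> and
      \<open>g w\<close>; with \<open>q\<close> at \<open>v\<close>, the colour \<open>g w\<close>
      must be at the other end \<open>u\<close>.\<close>
    have "x = u"
      using new_colours_at_vertex[of w u v x] W[OF wv(1)] hM u x New q gw wv by auto
    then have gu: "g w = c {w, u}" using x by simp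
    have vu: "{v, u} \<in> M" "{u, v} \<in> M" using hM u by (simp_all add: insert_commute)
    show "q = q'"
    proof (cases "w = w'")
      case True
      \<comment> \<open>Here v' = u would give q' = \<open>g w\<close>, so v' = v.\<close>
      then show ?thesis using wv wv' u gu gw by auto
    next
      case False
      have new: "c {w, u} \<notin> c ` M" "c {w, v} \<notin> c ` M" "c {w', v'} \<notin> c ` M"
        using New[of "g w"] New[of q] New[of q'] q q' x(1) gu wv(3) wv'(3) by auto
      \<comment> \<open>If v' = v, the edges from \<open>w\<close> to \<open>u\<close> and from
        \<open>w'\<close> to \<open>v\<close> would share their colour, giving q' =
        \<open>g w\<close>. So v' = u, and the same argument with the ends exchanged gives q =
        q'.\<close>
      have "v' \<noteq> v"
        using new_colours_at_edge[OF W[OF wv(1)] W[OF wv'(1)] False vu(2) new(1)] new(3) gw(2)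
          gu wv'(3) by auto
      then have "v' = u" using wv'(2) u by auto
      then show ?thesis
        using new_colours_at_edge[OF W[OF wv(1)] W[OF wv'(1)] False vu(1) new(2)] new(3)
          wv(3) wv'(3) by simp
    qed
  qed
  then have "card (New - g ` W) \<le> t + 2"
    unfolding card_M[symmetric] using h fin by (intro card_inj_on_le) auto
  moreover have "card (g ` W) \<le> card W" by (rule card_image_le[OF fin(2)])
  moreover have "card New \<le> card (g ` W) + card (New - g ` W)"
    using card_Un_le[of "g ` W" "New - g ` W"] card_mono[of "g ` W \<union> (New - g ` W)" New] fin by auto
  ultimately have New_le: "card New \<le> card W + (t + 2)" by linarith
  have n: "card W + 2 * (t + 2) = n"
    unfolding card_Union_M[symmetric] using card_Diff_subset[of "\<Union>M" "{..<n}"] card_mono[OF _ UM] UM finite_subset[OF UM] by (simp add: W_def)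
  have "card (c ` nsets {..<n} 2) \<le> card (c ` M) + card New"
  proof -
    have "c ` nsets {..<n} 2 = c ` M \<union> New" using M by (auto simp: New_def rainbow_matching_def)
    then show ?thesis using card_Un_le[of "c ` M" New] by simp
  qed
  moreover have "card (c ` M) \<le> t + 2"
    unfolding card_M[symmetric] by (rule card_image_le[OF fin(1)])
  ultimately have "card (c ` nsets {..<n} 2) \<le> (t + 2) + (card W + (t + 2))"
    using New_le by (meson add_mono le_trans)
  also have "\<dots> = n" using n by simp
  finally show ?thesis .
qed

end

end

section \<open>Comparison of the two maxima\<close>

theorem theorem3:
  fixes t n :: nat
  assumes "t \<ge> 1" and "n \<ge> 2 * t + 4"
  shows "anti_Ramsey n (disjoint_union (path_graph 4) (copies t (path_graph 2))) =
         anti_Ramsey n (copies (t + 2) (path_graph 2))"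
proof -
  let ?A = "color_counts n (path_matching t)" and ?B = "color_counts n (copies (t + 2) (path_graph 2))"
  have sub: "?B \<subseteq> ?A"
    unfolding color_counts_def using rainbow_path_matching_imp_rainbow_matching by blast
  \<comment> \<open>The assumption t >= 1 enters here as t + 2 >= 3. This membership makes both sets
    of counts nonempty and bounds \<open>Max ?B\<close> below by \<open>n\<close>.\<close>
  have n: "n \<in> ?B" using assms by (intro order_in_color_counts_matching) auto
  have "a \<le> Max ?B" if a: "a \<in> ?A" for a
  proof -
    obtain c :: "nat set \<Rightarrow> nat" where c: "a = card (c ` edges (complete_graph n))"
      "\<not> has_rainbow_copy c (complete_graph n) (path_matching t)"
      using a by (auto simp: color_counts_def)
    interpret no_rainbow_path_matching c n t by unfold_locales (rule c(2))
    show ?thesis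
    \<comment> \<open>A colouring with a rainbow matching of size t + 2 has at most \<open>n\<close>
      colours; any other is itself counted in \<open>?B\<close>.\<close>
    proof (cases "has_rainbow_copy c (complete_graph n) (copies (t + 2) (path_graph 2))")
      case True
      then obtain M where "rainbow_matching n c M" "card M = t + 2"
        by (rule rainbow_matching_of_copy)
      then have "a \<le> n" using card_colours_le c(1) by (simp add: complete_graph_def)
      also have "n \<le> Max ?B" using n by (intro Max_ge finite_color_counts)
      finally show ?thesis .
    next
      case False
      then have "a \<in> ?B" using c(1) by (auto simp: color_counts_def)
      then show ?thesis by (intro Max_ge finite_color_counts)
    qed
  qed
  then have "Max ?A \<le> Max ?B"
    using n sub by (intro Max.boundedI finite_color_counts) auto
  moreover have "Max ?B \<le> Max ?A"
    using n sub by (intro Max_mono finite_color_counts) auto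
  ultimately show ?thesis by (simp add: anti_Ramsey_def)
qed

end
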